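(* Let $\alpha>0$, let $\Omega\subset\mathbb{R}^d$ be an open convex set, and let $c^{(\alpha)}(x,y)=\frac1\alpha\log(1+\alpha\, x\cdot y)$ (for $x,y\in\mathbb{R}^d$ with $1+\alpha x\cdot y>0$). (1) Let $\varphi:\Omega\to\mathbb{R}$ be $\alpha$-exponentially concave and satisfy the regularity conditions (A) of the context. Let $\eta=D^{(\alpha)}\varphi(\xi)$ be the $\alpha$-gradient, $\Omega'=D^{(\alpha)}\varphi(\Omega)$, and let $\psi:\Omega'\to\mathbb{R}$ be the $\alpha$-conjugate of $\varphi$. Then $\psi$ is locally $\alpha$-exponentially concave, and the $L^{(\alpha)}$-divergence of $\varphi$ admits the self-dual representation $$\mathbf{D}^{(\alpha)}[\xi:\xi']=c^{(\alpha)}(\xi,\eta')-\varphi(\xi)-\psi(\eta'),\qquad \xi,\xi'\in\Omega,\ \eta'=D^{(\alpha)}\varphi(\xi').$$ (2) Let $\varphi:\Omega\to\mathbb{R}$ be $\alpha$-exponentially convex and satisfy the regularity conditions (B) of the context, and let $\eta=D^{(\alpha)}\varphi(\xi)$, $\Omega'=D^{(\alpha)}\varphi(\Omega)$ and $\psi:\Omega'\to\mathbb{R}$ be defined by the same formulas. Then $\psi$ is locally $\alpha$-exponentially convex, and the $L^{(-\alpha)}$-divergence of $\varphi$ admits the self-dual representation $$\mathbf{D}^{(-\alpha)}[\xi:\xi']=\varphi(\xi)+\psi(\eta')-c^{(\alpha)}(\xi,\eta'),\qquad \xi,\xi'\in\Omega,\ \eta'=D^{(\alpha)}\varphi(\x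i').$$
   Context: $D$ and $D^2$ denote the Euclidean gradient (column vector) and Hessian. A function $\varphi$ on an open convex set is $\alpha$-exponentially concave (resp. convex) if $e^{\alpha\varphi}$ is concave (resp. convex). Conditions (A): $\varphi$ is smooth on $\Omega$, the matrix $-D^2\varphi-\alpha(D\varphi)(D\varphi)^\top$ is strictly positive definite on $\Omega$, and $1-\alpha D\varphi(\xi)\cdot\xi>0$ for all $\xi\in\Omega$. Conditions (B): $\varphi$ is smooth on $\Omega$, the matrix $D^2\varphi+\alpha(D\varphi)(D\varphi)^\top$ is strictly positive definite on $\Omega$, $0\in\Omega$, and $1+\alpha D\varphi(\xi')\cdot(\xi-\xi')>0$ for all $\xi,\xi'\in\Omega$. $\alpha$-gradient: $D^{(\alpha)}\varphi(\xi)=\dfrac{D\varphi(\xi)}{1-\alpha D\varphi(\xi)\cdot\xi}$; under (A) or (B) it is injective on $\Omega$ with open image $\Omega'$ (not necessarily convex). The ($\alpha$- or $(-\alpha)$-) conjugate is $\psi(\eta)=c^{(\alpha)}(\xi,\eta)-\varphi(\xi)$ with $\xi=(D^{(\alpha)}\varphi)^{-1}(\eta)$, $\eta\in\Omega'$. $L^{(\alpha)}$-divergence of an $\alpha$-exponentially concave $\varphi$: $\mathbf{D}^{(\alpha)}[\xi:\xi']=\frac1\alpha\log\big(1+\alpha D\varphi(\xi')\cdot(\xi-\xi')\big)-(\varphi(\xi)-\varphi(\xi'))$. $L^{(-\alpha)}$-divergence of an $\alpha$-exponentially convex $\varphi$: $\mathbf{D}^{(-\alpha)}[\xi:\xi']=(\varphi(\xi)-\varphi(\xi'))-\frac1\alpha\log\big(1+\alpha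 D\varphi(\xi')\cdot(\xi-\xi')\big)$. "$\psi$ is locally $\alpha$-exponentially concave on $\Omega'$" means that $-D^2\psi-\alpha(D\psi)(D\psi)^\top$ is strictly positive definite at every point of $\Omega'$; "locally $\alpha$-exponentially convex" means that $D^2\psi+\alpha(D\psi)(D\psi)^\top$ is strictly positive definite at every point of $\Omega'$. *)

theory Defs
  imports "HOL-Analysis.Analysis"
begin

text \<open>
  Functions on an open set are total functions of which only the values on the set matter: all
  derivatives below are taken at points of open sets, where they depend only on the germ.
\<close>

definition gradient :: "(real^'d \<Rightarrow> real) \<Rightarrow> real^'d \<Rightarrow> real^'d" where
  "gradient f x = (\<chi> i. frechet_derivative f (at x) (axis i 1))"

definition hessian :: "(real^'d \<Rightarrow> real) \<Rightarrow> real^'d \<Rightarrow> real^'d^'d" where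
  "hessian f x = jacobian (gradient f) (at x)"

text \<open>The gradient is the one of \<^const>\<open>gderiv\<close>.\<close>

lemma GDERIV_gradient:
  fixes f :: "real^'d \<Rightarrow> real"
  assumes "f differentiable (at x)"
  shows "GDERIV f x :> gradient f x"
proof -
  let ?D = "frechet_derivative f (at x)"
  have D: "(f has_derivative ?D) (at x)"
    using assms by (simp add: frechet_derivative_works)
  then have lin: "linear ?D"
    by (rule has_derivative_linear)
  have "?D h = h \<bullet> gradient f x" for h :: "real^'d"
  proof -
    have "?D h = ?D (\<Sum>i\<in>UNIV. h $ i *\<^sub>R axis i 1)"
      using basis_expansion[of h] by (simp add: scalar_mult_eq_scaleR)
    also have "\<dots> = (\<Sum>i\<in>UNIV. h $ i * ?D (axis i 1))"
      using lin by (simp add: linear_sum linear_cmul)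
    finally show ?thesis
      by (simp add: gradient_def inner_vec_def)
  qed
  then have "?D = (\<lambda>h. h \<bullet> gradient f x)"
    by (rule ext)
  then show ?thesis
    using D by (simp add: gderiv_def)
qed

text \<open>
  \<open>C\<^sup>k\<close> on an open set: the directional derivatives in all directions (equivalently, all partial
  derivatives) up to order \<open>k\<close> exist and are continuous. Intended for open \<open>S\<close>.
\<close>

fun Ck_on :: "nat \<Rightarrow> (real^'d) set \<Rightarrow> (real^'d \<Rightarrow> real) \<Rightarrow> bool" where
  "Ck_on 0 S f \<longleftrightarrow> continuous_on S f"
| "Ck_on (Suc k) S f \<longleftrightarrow>
     f differentiable_on S \<and> (\<forall>v. Ck_on k S (\<lambda>x. frechet_derivative f (at x) v))"

definition smooth_on :: "(real^'d) set \<Rightarrow> (real^'d \<Rightarrow> real) \<Rightarrow> bool" where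
  "smooth_on S f \<longleftrightarrow> (\<forall>k. Ck_on k S f)"

definition twice_differentiable_at :: "(real^'d \<Rightarrow> real) \<Rightarrow> real^'d \<Rightarrow> bool" where
  "twice_differentiable_at f x \<longleftrightarrow>
     (\<forall>\<^sub>F y in nhds x. f differentiable (at y)) \<and> gradient f differentiable (at x)"

definition positive_definite :: "real^'d^'d \<Rightarrow> bool" where
  "positive_definite A \<longleftrightarrow> transpose A = A \<and> (\<forall>v. v \<noteq> 0 \<longrightarrow> v \<bullet> (A *v v) > 0)"

definition outer_square :: "real^'d \<Rightarrow> real^'d^'d" where
  "outer_square v = (columnvector v :: real^1^'d) ** (rowvector v :: real^'d^1)"

definition exp_concave_on :: "real \<Rightarrow> (real^'d) set \<Rightarrow> (real^'d \<Rightarrow> real) \<Rightarrow> bool" where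
  "exp_concave_on \<alpha> S \<phi> \<longleftrightarrow> concave_on S (\<lambda>x. exp (\<alpha> * \<phi> x))"

definition exp_convex_on :: "real \<Rightarrow> (real^'d) set \<Rightarrow> (real^'d \<Rightarrow> real) \<Rightarrow> bool" where
  "exp_convex_on \<alpha> S \<phi> \<longleftrightarrow> convex_on S (\<lambda>x. exp (\<alpha> * \<phi> x))"

text \<open>
  The local notions include twice differentiability, so that the gradient and the Hessian
  in them are genuine derivatives.
\<close>

definition locally_exp_concave_on :: "real \<Rightarrow> (real^'d) set \<Rightarrow> (real^'d \<Rightarrow> real) \<Rightarrow> bool" where
  "locally_exp_concave_on \<alpha> S \<psi> \<longleftrightarrow>
     (\<forall>y\<in>S. twice_differentiable_at \<psi> y \<and>
        positive_definite (- hessian \<psi> y - \<alpha> *\<^sub>R outer_square (gradient \<psi> y)))"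

definition locally_exp_convex_on :: "real \<Rightarrow> (real^'d) set \<Rightarrow> (real^'d \<Rightarrow> real) \<Rightarrow> bool" where
  "locally_exp_convex_on \<alpha> S \<psi> \<longleftrightarrow>
     (\<forall>y\<in>S. twice_differentiable_at \<psi> y \<and>
        positive_definite (hessian \<psi> y + \<alpha> *\<^sub>R outer_square (gradient \<psi> y)))"

definition conditions_A :: "real \<Rightarrow> (real^'d) set \<Rightarrow> (real^'d \<Rightarrow> real) \<Rightarrow> bool" where
  "conditions_A \<alpha> \<Omega> \<phi> \<longleftrightarrow>
     smooth_on \<Omega> \<phi> \<and>
     (\<forall>\<xi>\<in>\<Omega>. positive_definite (- hessian \<phi> \<xi> - \<alpha> *\<^sub>R outer_square (gradient \<phi> \<xi>))) \<and>
     (\<forall>\<xi>\<in>\<Omega>. 1 - \<alpha> * (gradient \<phi> \<xi> \<bullet> \<xi>) > 0)"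

definition conditions_B :: "real \<Rightarrow> (real^'d) set \<Rightarrow> (real^'d \<Rightarrow> real) \<Rightarrow> bool" where
  "conditions_B \<alpha> \<Omega> \<phi> \<longleftrightarrow>
     smooth_on \<Omega> \<phi> \<and>
     (\<forall>\<xi>\<in>\<Omega>. positive_definite (hessian \<phi> \<xi> + \<alpha> *\<^sub>R outer_square (gradient \<phi> \<xi>))) \<and>
     0 \<in> \<Omega> \<and>
     (\<forall>\<xi>\<in>\<Omega>. \<forall>\<xi>'\<in>\<Omega>. 1 + \<alpha> * (gradient \<phi> \<xi>' \<bullet> (\<xi> - \<xi>')) > 0)"

text \<open>Meaningful for \<open>1 + \<alpha> * (x \<bullet> y) > 0\<close>.\<close>

definition log_cost :: "real \<Rightarrow> real^'d \<Rightarrow> real^'d \<Rightarrow> real" where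
  "log_cost \<alpha> x y = 1 / \<alpha> * ln (1 + \<alpha> * (x \<bullet> y))"

definition alpha_gradient :: "real \<Rightarrow> (real^'d \<Rightarrow> real) \<Rightarrow> real^'d \<Rightarrow> real^'d" where
  "alpha_gradient \<alpha> \<phi> \<xi> = (1 / (1 - \<alpha> * (gradient \<phi> \<xi> \<bullet> \<xi>))) *\<^sub>R gradient \<phi> \<xi>"

text \<open>
  Meaningful on \<open>alpha_gradient \<alpha> \<phi> ` \<Omega>\<close> when the \<open>\<alpha>\<close>-gradient is injective on \<open>\<Omega>\<close>, which follows
  from exponential concavity and \<^const>\<open>conditions_A\<close>, or from exponential convexity
  and \<^const>\<open>conditions_B\<close>.
\<close>

definition alpha_conjugate ::
    "real \<Rightarrow> (real^'d) set \<Rightarrow> (real^'d \<Rightarrow> real) \<Rightarrow> real^'d \<Rightarrow> real" where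
  "alpha_conjugate \<alpha> \<Omega> \<phi> \<eta> =
     (let \<xi> = the_inv_into \<Omega> (alpha_gradient \<alpha> \<phi>) \<eta> in log_cost \<alpha> \<xi> \<eta> - \<phi> \<xi>)"

definition L_divergence ::
    "real \<Rightarrow> (real^'d \<Rightarrow> real) \<Rightarrow> real^'d \<Rightarrow> real^'d \<Rightarrow> real" where
  "L_divergence \<alpha> \<phi> \<xi> \<xi>' =
     1 / \<alpha> * ln (1 + \<alpha> * (gradient \<phi> \<xi>' \<bullet> (\<xi> - \<xi>'))) - (\<phi> \<xi> - \<phi> \<xi>')"

text \<open>The \<open>L\<^sup>(\<^sup>-\<^sup>\<alpha>\<^sup>)\<close>-divergence; the parameter is still \<open>\<alpha> > 0\<close>.\<close>

definition L_neg_divergence ::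
    "real \<Rightarrow> (real^'d \<Rightarrow> real) \<Rightarrow> real^'d \<Rightarrow> real^'d \<Rightarrow> real" where
  "L_neg_divergence \<alpha> \<phi> \<xi> \<xi>' =
     (\<phi> \<xi> - \<phi> \<xi>') - 1 / \<alpha> * ln (1 + \<alpha> * (gradient \<phi> \<xi>' \<bullet> (\<xi> - \<xi>')))"

end

theory Submission
  imports Defs
begin

text \<open>
  Write \<open>g = D\<phi>(\<xi>)\<close>, \<open>p = 1 - \<alpha> g \<bullet> \<xi>\<close>, \<open>\<eta> = g / p\<close> and \<open>W = D\<^sup>2\<phi> + \<alpha> g g\<^sup>T\<close>. Since
  \<open>1 + \<alpha> \<xi> \<bullet> \<eta>' = (1 + \<alpha> g' \<bullet> (\<xi> - \<xi>')) / p'\<close>, the self-dual representation is the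
  logarithm of a quotient, once the \<open>\<alpha>\<close>-gradient is injective. Injectivity holds because the
  Hessian \<open>\<alpha> e\<^sup>\<alpha>\<^sup>\<phi> W\<close> of \<open>e\<^sup>\<alpha>\<^sup>\<phi>\<close> is definite: for \<open>\<xi> \<noteq> \<xi>'\<close> with \<open>\<eta> = \<eta>'\<close> the strict tangent
  inequality at \<open>\<xi>'\<close> compares \<open>e\<^sup>\<alpha>\<^sup>\<phi> p\<close> at the two points, and the one at \<open>\<xi>\<close> compares them
  the other way round.

  The derivative of the \<open>\<alpha>\<close>-gradient is \<open>L = (I + \<alpha> \<eta> \<xi>\<^sup>T) W / p\<close>, which is invertible. Hence the
  inverse is differentiable, \<open>D\<psi>(\<eta>) = p \<xi>\<close>, and
  \<open>D\<^sup>2\<psi> + \<alpha> D\<psi> D\<psi>\<^sup>T = p (I + \<alpha> \<xi> \<eta>\<^sup>T)\<^sup>-\<^sup>1 L\<^sup>-\<^sup>1\<close>, so that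
  \<open>L\<^sup>T (D\<^sup>2\<psi> + \<alpha> D\<psi> D\<psi>\<^sup>T) L = W\<close>: both matrices have the same symmetry and sign.
\<close>

section \<open>Gradients, Hessians and positive definite matrices\<close>

lemma gradient_eqI:
  fixes f :: "real^'d \<Rightarrow> real"
  assumes "(f has_derivative (\<lambda>h. h \<bullet> G)) (at x)"
  shows "gradient f x = G"
proof -
  have "frechet_derivative f (at x) = (\<lambda>h. h \<bullet> G)"
    using frechet_derivative_at[OF assms] by simp
  then show ?thesis
    by (simp add: gradient_def vec_eq_iff inner_axis')
qed

lemma has_derivative_gradient:
  fixes f :: "real^'d \<Rightarrow> real"
  assumes "f differentiable (at x)"
  shows "(f has_derivative (\<lambda>h. h \<bullet> gradient f x)) (at x)"
  using GDERIV_gradient[OF assms] by (simp add: gderiv_def)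

lemma has_derivative_hessian:
  fixes f :: "real^'d \<Rightarrow> real"
  assumes "gradient f differentiable (at x)"
  shows "(gradient f has_derivative (\<lambda>h. hessian f x *v h)) (at x)"
  using assms by (simp add: hessian_def jacobian_works)

lemma outer_square_mult_vec: "outer_square v *v u = (v \<bullet> u) *\<^sub>R v"
  by (simp add: vec_eq_iff outer_square_def matrix_vector_mult_def matrix_matrix_mult_def
      columnvector_def rowvector_def inner_vec_def sum_distrib_right sum_distrib_left
      mult.commute mult.left_commute)

text \<open>Symmetry as self-adjointness can be carried along a linear substitution without
  computing transposes.\<close>

lemma positive_definite_iff:
  fixes A :: "real^'d^'d"
  shows "positive_definite A \<longleftrightarrow>
    (\<forall>u v. u \<bullet> (A *v v) = (A *v u) \<bullet> v) \<and> (\<forall>v. v \<noteq> 0 \<longrightarrow> v \<bullet> (A *v v) > 0)"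
proof -
  have "transpose A = A \<longleftrightarrow> (\<forall>u v. u \<bullet> (A *v v) = (A *v u) \<bullet> v)"
  proof
    assume "transpose A = A"
    then show "\<forall>u v. u \<bullet> (A *v v) = (A *v u) \<bullet> v"
      by (metis dot_lmul_matrix transpose_matrix_vector)
  next
    assume sym: "\<forall>u v. u \<bullet> (A *v v) = (A *v u) \<bullet> v"
    have "transpose A *v u = A *v u" for u
    proof -
      have "(transpose A *v u) \<bullet> v = (A *v u) \<bullet> v" for v
        using sym by (metis dot_lmul_matrix transpose_matrix_vector)
      then show ?thesis
        by (metis vector_eq_rdot)
    qed
    then show "transpose A = A"
      by (simp add: matrix_eq)
  qed
  then show ?thesis
    by (simp add: positive_definite_def)
qed

text \<open>Order two of \<open>Ck_on\<close> makes every directional derivative differentiable;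
  those along the axes are the components of the gradient.\<close>

lemma smooth_on_imp_differentiable:
  fixes \<phi> :: "real^'d \<Rightarrow> real"
  assumes "smooth_on S \<phi>" and "open S" and "x \<in> S"
  shows "\<phi> differentiable (at x)" and "gradient \<phi> differentiable (at x)"
proof -
  have "Ck_on (Suc (Suc 0)) S \<phi>"
    using assms(1) unfolding smooth_on_def by blast
  then have 1: "\<phi> differentiable_on S"
    and 2: "\<And>v. (\<lambda>x. frechet_derivative \<phi> (at x) v) differentiable_on S"
    by auto
  show "\<phi> differentiable (at x)"
    using 1 assms(2,3) by (simp add: differentiable_on_eq_differentiable_at)
  have "(\<lambda>x. frechet_derivative \<phi> (at x) v) differentiable (at x)" for v
    using 2 assms(2,3) by (simp add: differentiable_on_eq_differentiable_at)
  then show "gradient \<phi> differentiable (at x)"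
    by (subst differentiable_componentwise_within)
      (auto simp: gradient_def Basis_vec_def inner_axis)
qed

section \<open>Common setting of the concave and the convex case\<close>

text \<open>
  The sign \<open>s\<close> is \<open>-1\<close> in the exponentially concave and \<open>1\<close> in the exponentially convex case.
\<close>

locale exp_curved =
  fixes \<alpha> s :: real and \<Omega> :: "(real^'d) set" and \<phi> :: "real^'d \<Rightarrow> real"
  assumes alpha_pos: "\<alpha> > 0"
    and open_domain: "open \<Omega>"
    and convex_domain: "convex \<Omega>"
    and differentiable: "x \<in> \<Omega> \<Longrightarrow> \<phi> differentiable (at x)"
    and gradient_differentiable: "x \<in> \<Omega> \<Longrightarrow> gradient \<phi> differentiable (at x)"
    and definite: "x \<in> \<Omega> \<Longrightarrow>
      positive_definite (s *\<^sub>R (hessian \<phi> x + \<alpha> *\<^sub>R outer_square (gradient \<phi> x)))"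
    and normalizer_pos: "x \<in> \<Omega> \<Longrightarrow> 1 - \<alpha> * (gradient \<phi> x \<bullet> x) > 0"
begin

abbreviation grad where "grad \<equiv> gradient \<phi>"

abbreviation agrad where "agrad \<equiv> alpha_gradient \<alpha> \<phi>"

abbreviation \<psi> where "\<psi> \<equiv> alpha_conjugate \<alpha> \<Omega> \<phi>"

abbreviation inv_agrad where "inv_agrad \<equiv> the_inv_into \<Omega> agrad"

definition normalizer :: "real^'d \<Rightarrow> real" where
  "normalizer x = 1 - \<alpha> * (grad x \<bullet> x)"

text \<open>The matrix \<open>W\<close> applied to a vector; as a map it reduces the computations to
  inner products.\<close>

definition curv :: "real^'d \<Rightarrow> real^'d \<Rightarrow> real^'d" where
  "curv x v = hessian \<phi> x *v v + (\<alpha> * (grad x \<bullet> v)) *\<^sub>R grad x"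

text \<open>The map \<open>L\<close>, written with \<open>curv\<close> so that the definiteness of
  \<open>W\<close> is at hand.\<close>

definition agrad_deriv :: "real^'d \<Rightarrow> real^'d \<Rightarrow> real^'d" where
  "agrad_deriv x v =
     (1 / normalizer x) *\<^sub>R (curv x v + (\<alpha> * (x \<bullet> curv x v)) *\<^sub>R agrad x)"

lemma normalizer_gt_0: "x \<in> \<Omega> \<Longrightarrow> normalizer x > 0"
  using normalizer_pos by (simp add: normalizer_def)

lemma agrad_eq: "agrad x = (1 / normalizer x) *\<^sub>R grad x"
  by (simp add: alpha_gradient_def normalizer_def)

lemma curv_matrix:
  "(hessian \<phi> x + \<alpha> *\<^sub>R outer_square (grad x)) *v v = curv x v"
  by (simp add: curv_def matrix_vector_mult_add_rdistrib outer_square_mult_vec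
      flip: scaleR_matrix_vector_assoc)

lemma sign_nonzero: "x \<in> \<Omega> \<Longrightarrow> s \<noteq> 0"
  using definite[of x] by (auto simp: positive_definite_def dest: spec[of _ "axis undefined 1"])

lemma curv_sym: "x \<in> \<Omega> \<Longrightarrow> u \<bullet> curv x v = curv x u \<bullet> v"
  using definite[of x] sign_nonzero[of x]
  by (simp add: positive_definite_iff curv_matrix flip: scaleR_matrix_vector_assoc)

lemma curv_definite: "x \<in> \<Omega> \<Longrightarrow> v \<noteq> 0 \<Longrightarrow> s * (v \<bullet> curv x v) > 0"
  using definite[of x]
  by (simp add: positive_definite_iff curv_matrix flip: scaleR_matrix_vector_assoc)

text \<open>The numerator is \<open>normalizer x + \<alpha> * (grad x \<bullet> y)\<close>. This
  ties the argument of the cost to that of the divergence.\<close>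

lemma cost_arg:
  assumes "x \<in> \<Omega>"
  shows "1 + \<alpha> * (y \<bullet> agrad x) = (1 + \<alpha> * (grad x \<bullet> (y - x))) / normalizer x"
  using normalizer_gt_0[OF assms]
  by (simp add: agrad_eq field_simps inner_diff_right inner_commute normalizer_def)

lemma cost_arg_self:
  assumes "x \<in> \<Omega>"
  shows "1 + \<alpha> * (x \<bullet> agrad x) = 1 / normalizer x"
  using cost_arg[OF assms, of x] by simp

section \<open>Strict tangent inequality and injectivity of the \<alpha>-gradient\<close>

text \<open>On the segment from \<open>x\<close> to \<open>y\<close> the second derivative of
  \<open>exp (\<alpha> * \<phi>)\<close> has the sign of \<open>s\<close>; applying the mean value
  theorem twice gives the strict inequality.\<close>

lemma strict_tangent:
  assumes x: "x \<in> \<Omega>" and y: "y \<in> \<Omega>" and "x \<noteq> y"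
  shows "s * (exp (\<alpha> * \<phi> y) - exp (\<alpha> * \<phi> x) * (1 + \<alpha> * (grad x \<bullet> (y - x)))) > 0"
proof -
  define v where "v = y - x"
  define \<gamma> where "\<gamma> t = x + t *\<^sub>R v" for t
  define f where "f t = exp (\<alpha> * \<phi> (\<gamma> t))" for t
  define f' where "f' t = f t * (\<alpha> * (grad (\<gamma> t) \<bullet> v))" for t
  have in_domain: "\<gamma> t \<in> \<Omega>" if "0 \<le> t" "t \<le> 1" for t
  proof -
    have "\<gamma> t = (1 - t) *\<^sub>R x + t *\<^sub>R y"
      by (simp add: \<gamma>_def v_def algebra_simps)
    then show ?thesis
      using convexD[OF convex_domain x y, of "1 - t" t] that by simp
  qed
  have \<gamma>_deriv: "(\<gamma> has_derivative (\<lambda>h. h *\<^sub>R v)) (at t)" for t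
    unfolding \<gamma>_def by (auto intro!: derivative_eq_intros)
  have phi_deriv: "((\<lambda>t. \<phi> (\<gamma> t)) has_real_derivative grad (\<gamma> t) \<bullet> v) (at t)"
    if "0 \<le> t" "t \<le> 1" for t
    using has_derivative_compose[OF \<gamma>_deriv
        has_derivative_gradient[OF differentiable[OF in_domain[OF that]]]]
    by (simp add: has_field_derivative_def inner_commute mult_commute_abs)
  have f_deriv: "(f has_real_derivative f' t) (at t)" if "0 \<le> t" "t \<le> 1" for t
    unfolding f_def[abs_def] f'_def by (auto intro!: derivative_eq_intros phi_deriv that)
  have grad_deriv: "((\<lambda>t. grad (\<gamma> t) \<bullet> v) has_real_derivative
      (hessian \<phi> (\<gamma> t) *v v) \<bullet> v) (at t)" if "0 \<le> t" "t \<le> 1" for t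
    using has_derivative_inner_left[OF has_derivative_compose[OF \<gamma>_deriv
        has_derivative_hessian[OF gradient_differentiable[OF in_domain[OF that]]]], of v]
    by (simp add: has_field_derivative_def matrix_vector_mult_scaleR mult_commute_abs)
  \<comment> \<open>The square of \<open>grad (\<gamma> t) \<bullet> v\<close> that arises from
    differentiating \<open>f\<close> is the rank-one term of \<open>curv\<close>.\<close>
  have f'_deriv: "(f' has_real_derivative \<alpha> * f t * (v \<bullet> curv (\<gamma> t) v)) (at t)"
    if "0 \<le> t" "t \<le> 1" for t
    unfolding f'_def[abs_def]
    by (rule derivative_eq_intros f_deriv grad_deriv refl that)+
      (simp add: f'_def curv_def inner_right_distrib inner_commute algebra_simps)
  obtain c where c: "0 < c" "c < 1" "f 1 - f 0 = (1 - 0) * f' c"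
    using MVT2[of 0 1 f f'] f_deriv by auto
  \<comment> \<open>As \<open>f' c = f 1 - f 0\<close>, the increment of \<open>f'\<close> on
    \<open>[0, c]\<close> is the gap between \<open>f 1\<close> and its tangent value at 0.\<close>
  obtain d where d: "0 < d" "d < c"
    "f' c - f' 0 = (c - 0) * (\<alpha> * f d * (v \<bullet> curv (\<gamma> d) v))"
    using MVT2[of 0 c f' "\<lambda>t. \<alpha> * f t * (v \<bullet> curv (\<gamma> t) v)"] f'_deriv c by auto
  have "v \<noteq> 0"
    using assms by (simp add: v_def)
  then have "s * (v \<bullet> curv (\<gamma> d) v) > 0"
    using curv_definite in_domain c d by simp
  then have "c * \<alpha> * f d * (s * (v \<bullet> curv (\<gamma> d) v)) > 0"
    using c alpha_pos by (simp add: f_def)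
  also have "c * \<alpha> * f d * (s * (v \<bullet> curv (\<gamma> d) v)) = s * (f 1 - f 0 - f' 0)"
    using c d by (simp add: mult.commute mult.left_commute)
  finally show ?thesis
    by (simp add: f_def f'_def \<gamma>_def v_def algebra_simps)
qed

lemma inj_agrad: "inj_on agrad \<Omega>"
proof (rule inj_onI, rule ccontr)
  fix x y assume x: "x \<in> \<Omega>" and y: "y \<in> \<Omega>" and eq: "agrad x = agrad y" and "x \<noteq> y"
  have less: "s * (exp (\<alpha> * \<phi> b) * normalizer b - exp (\<alpha> * \<phi> a) * normalizer a) > 0"
    if a: "a \<in> \<Omega>" and b: "b \<in> \<Omega>" and "agrad a = agrad b" "a \<noteq> b" for a b
  proof -
    have pos: "normalizer a > 0" "normalizer b > 0"
      using a b by (simp_all add: normalizer_gt_0)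
    \<comment> \<open>Both sides are \<open>1 + \<alpha> * (b \<bullet> \<eta>)\<close> for the
      common \<alpha>-gradient \<eta> of \<open>a\<close> and \<open>b\<close>.\<close>
    have "(1 + \<alpha> * (grad a \<bullet> (b - a))) / normalizer a = 1 / normalizer b"
      using cost_arg[OF a, of b] cost_arg_self[OF b] that by simp
    then have "1 + \<alpha> * (grad a \<bullet> (b - a)) = normalizer a / normalizer b"
      using pos by (simp add: field_simps)
    then have "s * (exp (\<alpha> * \<phi> b) - exp (\<alpha> * \<phi> a) * (normalizer a / normalizer b)) > 0"
      using strict_tangent[OF a b \<open>a \<noteq> b\<close>] by simp
    then have "normalizer b *
        (s * (exp (\<alpha> * \<phi> b) - exp (\<alpha> * \<phi> a) * (normalizer a / normalizer b))) > 0"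
      using pos by simp
    also have "normalizer b *
        (s * (exp (\<alpha> * \<phi> b) - exp (\<alpha> * \<phi> a) * (normalizer a / normalizer b))) =
        s * (exp (\<alpha> * \<phi> b) * normalizer b - exp (\<alpha> * \<phi> a) * normalizer a)"
      using pos by (simp add: field_simps)
    finally show ?thesis .
  qed
  \<comment> \<open>The two instances assert that a number and its negative are positive.\<close>
  from less[OF x y] less[OF y x] eq \<open>x \<noteq> y\<close> show False
    by (simp add: algebra_simps)
qed

lemma inv_agrad: "x \<in> \<Omega> \<Longrightarrow> inv_agrad (agrad x) = x"
  by (rule the_inv_into_f_f[OF inj_agrad])

section \<open>The conjugate and the self-dual representation\<close>

lemma conj_agrad:
  "x \<in> \<Omega> \<Longrightarrow> \<psi> (agrad x) = - (1 / \<alpha> * ln (normalizer x)) - \<phi> x"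
  using normalizer_gt_0[of x]
  by (simp add: alpha_conjugate_def inv_agrad log_cost_def cost_arg_self ln_div)

text \<open>Positivity lets the logarithm of the quotient in \<open>cost_arg\<close> split, and
  \<open>ln (normalizer x)\<close> cancels against the conjugate. Both cases use this form, since
  \<open>L_neg_divergence\<close> is the negative of \<open>L_divergence\<close>.\<close>

lemma self_dual:
  assumes x: "x \<in> \<Omega>" and "1 + \<alpha> * (grad x \<bullet> (y - x)) > 0"
  shows "L_divergence \<alpha> \<phi> y x = log_cost \<alpha> y (agrad x) - \<phi> y - \<psi> (agrad x)"
proof -
  have "log_cost \<alpha> y (agrad x) =
      1 / \<alpha> * (ln (1 + \<alpha> * (grad x \<bullet> (y - x))) - ln (normalizer x))"
    unfolding log_cost_def cost_arg[OF x]
    using assms(2) normalizer_gt_0[OF x] by (subst ln_div) auto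
  then show ?thesis
    by (simp add: L_divergence_def conj_agrad[OF x] diff_divide_distrib)
qed

section \<open>Derivatives of the \<alpha>-gradient and of its inverse\<close>

lemma has_derivative_agrad:
  assumes x: "x \<in> \<Omega>"
  shows "(agrad has_derivative agrad_deriv x) (at x)"
proof -
  note [derivative_intros] = has_derivative_hessian[OF gradient_differentiable[OF x]]
  have p: "normalizer x \<noteq> 0"
    using normalizer_gt_0[OF x] by simp
  have p_deriv: "(normalizer has_derivative
      (\<lambda>h. - (\<alpha> * (grad x \<bullet> h + (hessian \<phi> x *v h) \<bullet> x)))) (at x)"
    unfolding normalizer_def[abs_def] by (auto intro!: derivative_eq_intros)
  have "((\<lambda>x. inverse (normalizer x) *\<^sub>R grad x) has_derivative agrad_deriv x) (at x)"
  proof (rule derivative_eq_intros p_deriv refl p)+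
    show "(\<lambda>h. inverse (normalizer x) *\<^sub>R (hessian \<phi> x *v h) +
        (- (inverse (normalizer x) * - (\<alpha> * (grad x \<bullet> h + (hessian \<phi> x *v h) \<bullet> x)) *
          inverse (normalizer x))) *\<^sub>R grad x) = agrad_deriv x"
    proof
      fix h
      define q where "q = grad x \<bullet> h"
      define r where "r = (hessian \<phi> x *v h) \<bullet> x"
      \<comment> \<open>Here \<open>\<alpha> * (grad x \<bullet> x)\<close> is replaced by
        \<open>1 - normalizer x\<close>.\<close>
      have scal: "x \<bullet> curv x h = r + (1 - normalizer x) * q"
        by (simp add: curv_def q_def r_def normalizer_def inner_right_distrib inner_commute)
      have "agrad_deriv x h = inverse (normalizer x) *\<^sub>R (hessian \<phi> x *v h) +
          (inverse (normalizer x) * (\<alpha> * q) +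
           inverse (normalizer x) * (\<alpha> * (r + (1 - normalizer x) * q)) * inverse (normalizer x))
            *\<^sub>R grad x"
        unfolding agrad_deriv_def scal
        by (simp add: curv_def q_def agrad_eq algebra_simps divide_inverse)
      \<comment> \<open>With \<open>p = normalizer x\<close> this is
        \<open>p q + r + (1 - p) q = q + r\<close>, up to the factor
        \<open>\<alpha> / p^2\<close>.\<close>
      also have "inverse (normalizer x) * (\<alpha> * q) +
           inverse (normalizer x) * (\<alpha> * (r + (1 - normalizer x) * q)) * inverse (normalizer x)
         = - (inverse (normalizer x) * - (\<alpha> * (q + r)) * inverse (normalizer x))"
        using p by (simp add: field_simps)
      finally show "inverse (normalizer x) *\<^sub>R (hessian \<phi> x *v h) +
        (- (inverse (normalizer x) * - (\<alpha> * (grad x \<bullet> h + (hessian \<phi> x *v h) \<bullet> x)) *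
          inverse (normalizer x))) *\<^sub>R grad x = agrad_deriv x h"
        by (simp add: q_def r_def)
    qed
  qed
  then show ?thesis
    by (simp add: agrad_eq[abs_def] divide_inverse)
qed

lemma linear_agrad_deriv: "x \<in> \<Omega> \<Longrightarrow> linear (agrad_deriv x)"
  using has_derivative_agrad by (rule has_derivative_linear)

text \<open>
  By Sherman--Morrison, \<open>I - \<alpha> p \<xi> \<eta>\<^sup>T\<close> is the inverse of \<open>I + \<alpha> \<xi> \<eta>\<^sup>T\<close>, whose transpose occurs in
  the derivative of the \<open>\<alpha>\<close>-gradient.
\<close>

lemma agrad_deriv_inner:
  assumes x: "x \<in> \<Omega>"
  shows "agrad_deriv x u \<bullet>
      (normalizer x *\<^sub>R (v - (\<alpha> * normalizer x * (agrad x \<bullet> v)) *\<^sub>R x)) = curv x u \<bullet> v"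
proof -
  define p where "p = normalizer x"
  define w where "w = curv x u"
  have p: "p > 0" and k: "\<alpha> * (agrad x \<bullet> x) = 1 / p - 1"
    using normalizer_gt_0[OF x] cost_arg_self[OF x]
    by (simp_all add: p_def inner_commute algebra_simps)
  have "agrad_deriv x u \<bullet> (p *\<^sub>R (v - (\<alpha> * p * (agrad x \<bullet> v)) *\<^sub>R x)) =
    w \<bullet> v + \<alpha> * (x \<bullet> w) * (agrad x \<bullet> v) * (1 - p - p * (\<alpha> * (agrad x \<bullet> x)))"
    using p unfolding agrad_deriv_def p_def[symmetric] w_def[symmetric]
    by (simp add: inner_left_distrib inner_diff_right inner_commute[of w x] algebra_simps)
  \<comment> \<open>The last factor is \<open>1 - p - p (1 / p - 1) = 0\<close>.\<close>
  also have "\<dots> = w \<bullet> v"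
    unfolding k using p by (simp add: algebra_simps)
  finally show ?thesis
    by (simp add: p_def w_def)
qed

text \<open>If \<open>L v = 0\<close>, then \<open>agrad_deriv_inner\<close> gives
  \<open>curv x v \<bullet> v = 0\<close>, so \<open>v = 0\<close> by definiteness.\<close>

lemma inj_agrad_deriv:
  assumes x: "x \<in> \<Omega>"
  shows "inj (agrad_deriv x)"
proof -
  have "v = 0" if "agrad_deriv x v = 0" for v
    using agrad_deriv_inner[OF x, of v v] curv_definite[OF x, of v] that
    by (force simp: inner_commute)
  then show ?thesis
    by (simp add: linear_injective_0[OF linear_agrad_deriv[OF x]])
qed

lemma continuous_on_agrad: "continuous_on \<Omega> agrad"
  using has_derivative_agrad has_derivative_continuous
  by (intro continuous_at_imp_continuous_on) blast

lemma open_image_agrad: "open (agrad ` \<Omega>)"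
  by (rule invariance_of_domain[OF continuous_on_agrad open_domain inj_agrad])

text \<open>An injective linear self-map in finite dimension is onto, so \<open>inv\<close> is a
  right inverse of the derivative. As \<open>inv_agrad\<close> already inverts the continuous map on
  all of \<open>\<Omega>\<close>, differentiability at the single point \<open>x\<close>
  suffices.\<close>

lemma has_derivative_inv_agrad:
  assumes x: "x \<in> \<Omega>"
  shows "(inv_agrad has_derivative inv (agrad_deriv x)) (at (agrad x))"
proof -
  have "surj (agrad_deriv x)"
    using linear_inj_imp_surj[OF linear_agrad_deriv[OF x] inj_agrad_deriv[OF x]] .
  then have "agrad_deriv x \<circ> inv (agrad_deriv x) = id"
    by (simp add: surj_iff)
  then show ?thesis
    using has_derivative_inverse_strong[of \<Omega> x agrad inv_agrad, OF open_domain x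
        continuous_on_agrad inv_agrad has_derivative_agrad[OF x]]
    by simp
qed

section \<open>First and second derivatives of the conjugate\<close>

text \<open>An envelope argument: the terms that contain the derivative of the inverse cancel
  because \<open>grad x = normalizer x *\<^sub>R agrad x\<close>.\<close>

lemma has_derivative_conj:
  assumes x: "x \<in> \<Omega>"
  shows "(\<psi> has_derivative (\<lambda>h. h \<bullet> (normalizer x *\<^sub>R x))) (at (agrad x))"
proof -
  define y where "y = agrad x"
  define G where "G = inv (agrad_deriv x)"
  have xy: "inv_agrad y = x"
    using inv_agrad[OF x] by (simp add: y_def)
  have arg: "1 + \<alpha> * (x \<bullet> y) = 1 / normalizer x" and p: "normalizer x > 0"
    using cost_arg_self[OF x] normalizer_gt_0[OF x] by (simp_all add: y_def)
  have gy: "grad x = normalizer x *\<^sub>R y"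
    using p by (simp add: y_def agrad_eq)
  have G: "(inv_agrad has_derivative G) (at y)"
    using has_derivative_inv_agrad[OF x] by (simp add: y_def G_def)
  have phi: "(\<phi> has_derivative (\<lambda>h. h \<bullet> grad x)) (at (inv_agrad y))"
    using has_derivative_gradient[OF differentiable[OF x]] by (simp add: xy)
  have arg_deriv: "((\<lambda>y. 1 + \<alpha> * (inv_agrad y \<bullet> y)) has_derivative
      (\<lambda>h. \<alpha> * (x \<bullet> h + G h \<bullet> y))) (at y)"
    by (auto intro!: derivative_eq_intros G simp: xy)
  have "((\<lambda>y. 1 / \<alpha> * ln (1 + \<alpha> * (inv_agrad y \<bullet> y)) - \<phi> (inv_agrad y)) has_derivative
      (\<lambda>h. 1 / \<alpha> * (\<alpha> * (x \<bullet> h + G h \<bullet> y) * inverse (1 + \<alpha> * (inv_agrad y \<bullet> y)))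
         - G h \<bullet> grad x)) (at y)"
    by (intro has_derivative_diff has_derivative_mult_right has_derivative_ln arg_deriv
        has_derivative_compose[OF G phi]) (simp add: xy arg p)
  moreover have "1 / \<alpha> * (\<alpha> * (x \<bullet> h + G h \<bullet> y) * inverse (1 + \<alpha> * (inv_agrad y \<bullet> y)))
         - G h \<bullet> grad x = h \<bullet> (normalizer x *\<^sub>R x)" for h
    using alpha_pos by (simp add: xy arg gy inner_commute algebra_simps)
  moreover have "\<psi> = (\<lambda>y. 1 / \<alpha> * ln (1 + \<alpha> * (inv_agrad y \<bullet> y)) - \<phi> (inv_agrad y))"
    by (simp add: fun_eq_iff alpha_conjugate_def log_cost_def Let_def)
  ultimately show ?thesis
    by (simp add: y_def)
qed

lemma gradient_conj: "x \<in> \<Omega> \<Longrightarrow> gradient \<psi> (agrad x) = normalizer x *\<^sub>R x"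
  by (rule gradient_eqI[OF has_derivative_conj])

text \<open>By \<open>cost_arg_self\<close>, the gradient \<open>normalizer x *\<^sub>R x\<close> of
  the conjugate is \<open>inv_agrad y\<close> divided by
  \<open>1 + \<alpha> * (inv_agrad y \<bullet> y)\<close>, which is differentiated through the
  inverse alone.\<close>

lemma has_derivative_gradient_conj:
  assumes x: "x \<in> \<Omega>"
  shows "(gradient \<psi> has_derivative
    (\<lambda>h. normalizer x *\<^sub>R inv (agrad_deriv x) h
       - (\<alpha> * (normalizer x)\<^sup>2 * (x \<bullet> h + agrad x \<bullet> inv (agrad_deriv x) h)) *\<^sub>R x)) (at (agrad x))"
proof -
  define y where "y = agrad x"
  define G where "G = inv (agrad_deriv x)"
  have xy: "inv_agrad y = x"
    using inv_agrad[OF x] by (simp add: y_def)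
  have arg: "1 + \<alpha> * (x \<bullet> y) = 1 / normalizer x" and p: "normalizer x > 0"
    using cost_arg_self[OF x] normalizer_gt_0[OF x] by (simp_all add: y_def)
  have G: "(inv_agrad has_derivative G) (at y)"
    using has_derivative_inv_agrad[OF x] by (simp add: y_def G_def)
  have arg_deriv: "((\<lambda>y. 1 + \<alpha> * (inv_agrad y \<bullet> y)) has_derivative
      (\<lambda>h. \<alpha> * (x \<bullet> h + G h \<bullet> y))) (at y)"
    by (auto intro!: derivative_eq_intros G simp: xy)
  have nz: "1 + \<alpha> * (inv_agrad y \<bullet> y) \<noteq> 0"
    using p by (simp add: xy arg)
  have "((\<lambda>y. inverse (1 + \<alpha> * (inv_agrad y \<bullet> y)) *\<^sub>R inv_agrad y) has_derivative
      (\<lambda>h. inverse (1 + \<alpha> * (inv_agrad y \<bullet> y)) *\<^sub>R G h +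
        (- (inverse (1 + \<alpha> * (inv_agrad y \<bullet> y)) * (\<alpha> * (x \<bullet> h + G h \<bullet> y)) *
          inverse (1 + \<alpha> * (inv_agrad y \<bullet> y)))) *\<^sub>R inv_agrad y)) (at y)"
    by (rule has_derivative_scaleR[OF Deriv.has_derivative_inverse[OF nz arg_deriv] G])
  moreover have "inverse (1 + \<alpha> * (inv_agrad y \<bullet> y)) *\<^sub>R G h +
        (- (inverse (1 + \<alpha> * (inv_agrad y \<bullet> y)) * (\<alpha> * (x \<bullet> h + G h \<bullet> y)) *
          inverse (1 + \<alpha> * (inv_agrad y \<bullet> y)))) *\<^sub>R inv_agrad y =
      normalizer x *\<^sub>R G h - (\<alpha> * (normalizer x)\<^sup>2 * (x \<bullet> h + y \<bullet> G h)) *\<^sub>R x" for h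
    unfolding xy arg by (simp add: power2_eq_square inner_commute[of y] algebra_simps)
  ultimately have "((\<lambda>y. inverse (1 + \<alpha> * (inv_agrad y \<bullet> y)) *\<^sub>R inv_agrad y) has_derivative
      (\<lambda>h. normalizer x *\<^sub>R G h - (\<alpha> * (normalizer x)\<^sup>2 * (x \<bullet> h + y \<bullet> G h)) *\<^sub>R x)) (at y)"
    by simp
  then have "(gradient \<psi> has_derivative
      (\<lambda>h. normalizer x *\<^sub>R G h - (\<alpha> * (normalizer x)\<^sup>2 * (x \<bullet> h + y \<bullet> G h)) *\<^sub>R x)) (at y)"
  proof (rule has_derivative_transform_within_open[OF _ open_image_agrad])
    show "y \<in> agrad ` \<Omega>"
      using x by (simp add: y_def)
    show "inverse (1 + \<alpha> * (inv_agrad z \<bullet> z)) *\<^sub>R inv_agrad z = gradient \<psi> z"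
      if "z \<in> agrad ` \<Omega>" for z
      using that by (auto simp: inv_agrad gradient_conj cost_arg_self)
  qed
  then show ?thesis
    by (simp add: y_def G_def)
qed

text \<open>Evaluation at \<open>L v\<close> removes the inverse of \<open>L\<close>, and the outer
  square cancels the Hessian term in \<open>x \<bullet> L v\<close>.\<close>

lemma conj_curv:
  assumes x: "x \<in> \<Omega>"
  shows "(hessian \<psi> (agrad x) + \<alpha> *\<^sub>R outer_square (gradient \<psi> (agrad x)))
      *v agrad_deriv x v =
    normalizer x *\<^sub>R (v - (\<alpha> * normalizer x * (agrad x \<bullet> v)) *\<^sub>R x)"
proof -
  have G: "inv (agrad_deriv x) (agrad_deriv x v) = v"
    using inj_agrad_deriv[OF x] by simp
  have "gradient \<psi> differentiable (at (agrad x))"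
    using has_derivative_gradient_conj[OF x] by (rule differentiableI)
  from has_derivative_unique[OF has_derivative_hessian[OF this]
      has_derivative_gradient_conj[OF x], THEN fun_cong]
  have "hessian \<psi> (agrad x) *v agrad_deriv x v = normalizer x *\<^sub>R v
       - (\<alpha> * (normalizer x)\<^sup>2 * (x \<bullet> agrad_deriv x v + agrad x \<bullet> v)) *\<^sub>R x"
    by (simp add: G)
  then show ?thesis
    by (simp add: matrix_vector_mult_add_rdistrib outer_square_mult_vec gradient_conj[OF x]
        power2_eq_square algebra_simps flip: scaleR_matrix_vector_assoc)
qed

section \<open>Local exponential concavity and convexity of the conjugate\<close>

lemma twice_differentiable_conj:
  assumes "y \<in> agrad ` \<Omega>"
  shows "twice_differentiable_at \<psi> y"
  unfolding twice_differentiable_at_def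
proof
  have "\<psi> differentiable (at z)" if "z \<in> agrad ` \<Omega>" for z
    using that has_derivative_conj by (auto intro: differentiableI)
  then show "\<forall>\<^sub>F z in nhds y. \<psi> differentiable (at z)"
    using open_image_agrad assms eventually_nhds by blast
  show "gradient \<psi> differentiable (at y)"
    using assms has_derivative_gradient_conj by (auto intro: differentiableI)
qed

lemma definite_conj:
  assumes "y \<in> agrad ` \<Omega>"
  shows "positive_definite (s *\<^sub>R (hessian \<psi> y + \<alpha> *\<^sub>R outer_square (gradient \<psi> y)))"
proof -
  obtain x where x: "x \<in> \<Omega>" and y: "y = agrad x"
    using assms by blast
  define N where "N = hessian \<psi> y + \<alpha> *\<^sub>R outer_square (gradient \<psi> y)"
  let ?L = "agrad_deriv x"
  have surj: "\<exists>v. u = ?L v" for u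
    using linear_inj_imp_surj[OF linear_agrad_deriv[OF x] inj_agrad_deriv[OF x]]
    by (metis surjD)
  \<comment> \<open>By \<open>conj_curv\<close>, \<open>N\<close> sends \<open>L v\<close> to
    exactly the vector that \<open>agrad_deriv_inner\<close> pairs with \<open>L u\<close>.\<close>
  have form: "?L u \<bullet> (N *v ?L v) = curv x u \<bullet> v" for u v
    using agrad_deriv_inner[OF x] conj_curv[OF x] by (simp add: N_def y)
  have "u \<bullet> (N *v v) = (N *v u) \<bullet> v" for u v
  proof -
    obtain u' v' where uv: "u = ?L u'" "v = ?L v'"
      using surj by metis
    show ?thesis
      unfolding uv using form curv_sym[OF x, of v' u'] by (simp add: inner_commute)
  qed
  moreover have "s * (u \<bullet> (N *v u)) > 0" if "u \<noteq> 0" for u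
  proof -
    obtain v where v: "u = ?L v"
      using surj by metis
    then have "v \<noteq> 0"
      using that linear_0[OF linear_agrad_deriv[OF x]] by auto
    then show ?thesis
      using curv_definite[OF x, of v] by (simp add: v form inner_commute)
  qed
  ultimately show ?thesis
    by (simp add: positive_definite_iff N_def[symmetric] flip: scaleR_matrix_vector_assoc)
qed

end

section \<open>Specialisation to conditions (A) and (B)\<close>

lemma exp_curved_A:
  assumes "\<alpha> > 0" "open \<Omega>" "convex \<Omega>" and A: "conditions_A \<alpha> \<Omega> \<phi>"
  shows "exp_curved \<alpha> (- 1) \<Omega> \<phi>"
proof
  have smooth: "smooth_on \<Omega> \<phi>"
    using A by (simp add: conditions_A_def)
  fix x assume x: "x \<in> \<Omega>"
  show "\<phi> differentiable (at x)" "gradient \<phi> differentiable (at x)"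
    using smooth_on_imp_differentiable[OF smooth \<open>open \<Omega>\<close> x] by simp_all
  show "positive_definite (- 1 *\<^sub>R (hessian \<phi> x + \<alpha> *\<^sub>R outer_square (gradient \<phi> x)))"
    "1 - \<alpha> * (gradient \<phi> x \<bullet> x) > 0"
    using A x by (simp_all add: conditions_A_def)
qed (fact assms)+

lemma exp_curved_B:
  assumes "\<alpha> > 0" "open \<Omega>" "convex \<Omega>" and B: "conditions_B \<alpha> \<Omega> \<phi>"
  shows "exp_curved \<alpha> 1 \<Omega> \<phi>"
proof
  have smooth: "smooth_on \<Omega> \<phi>"
    using B by (simp add: conditions_B_def)
  fix x assume x: "x \<in> \<Omega>"
  show "\<phi> differentiable (at x)" "gradient \<phi> differentiable (at x)"
    using smooth_on_imp_differentiable[OF smooth \<open>open \<Omega>\<close> x] by simp_all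
  show "positive_definite (1 *\<^sub>R (hessian \<phi> x + \<alpha> *\<^sub>R outer_square (gradient \<phi> x)))"
    using B x by (simp add: conditions_B_def)
  \<comment> \<open>Since \<open>0 \<in> \<Omega>\<close>, the last condition of (B) may be taken
    with \<xi> = 0, where its left side is the normalizer.\<close>
  have "1 + \<alpha> * (gradient \<phi> x \<bullet> (0 - x)) > 0"
    using B x unfolding conditions_B_def by blast
  then show "1 - \<alpha> * (gradient \<phi> x \<bullet> x) > 0"
    by simp
qed (fact assms)+

theorem theorem1:
  fixes \<alpha> :: real and \<Omega> :: "(real^'d) set"
  assumes "\<alpha> > 0" and "open \<Omega>" and "convex \<Omega>"
  shows
    "(\<forall>\<phi>. exp_concave_on \<alpha> \<Omega> \<phi> \<and> conditions_A \<alpha> \<Omega> \<phi> \<longrightarrow>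
        locally_exp_concave_on \<alpha> (alpha_gradient \<alpha> \<phi> ` \<Omega>) (alpha_conjugate \<alpha> \<Omega> \<phi>) \<and>
        (\<forall>\<xi>\<in>\<Omega>. \<forall>\<xi>'\<in>\<Omega>. \<forall>\<eta>'. \<eta>' = alpha_gradient \<alpha> \<phi> \<xi>' \<longrightarrow>
           L_divergence \<alpha> \<phi> \<xi> \<xi>' = log_cost \<alpha> \<xi> \<eta>' - \<phi> \<xi> - alpha_conjugate \<alpha> \<Omega> \<phi> \<eta>'))
     \<and>
     (\<forall>\<phi>. exp_convex_on \<alpha> \<Omega> \<phi> \<and> conditions_B \<alpha> \<Omega> \<phi> \<longrightarrow>
        locally_exp_convex_on \<alpha> (alpha_gradient \<alpha> \<phi> ` \<Omega>) (alpha_conjugate \<alpha> \<Omega> \<phi>) \<and>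
        (\<forall>\<xi>\<in>\<Omega>. \<forall>\<xi>'\<in>\<Omega>. \<forall>\<eta>'. \<eta>' = alpha_gradient \<alpha> \<phi> \<xi>' \<longrightarrow>
           L_neg_divergence \<alpha> \<phi> \<xi> \<xi>' = \<phi> \<xi> + alpha_conjugate \<alpha> \<Omega> \<phi> \<eta>' - log_cost \<alpha> \<xi> \<eta>'))"
proof (intro conjI allI impI)
  fix \<phi> :: "real^'d \<Rightarrow> real"
  assume "exp_concave_on \<alpha> \<Omega> \<phi> \<and> conditions_A \<alpha> \<Omega> \<phi>"
  then interpret exp_curved \<alpha> "- 1" \<Omega> \<phi>
    using exp_curved_A[OF assms] by blast
  show "locally_exp_concave_on \<alpha> (agrad ` \<Omega>) \<psi>"
    using twice_differentiable_conj definite_conj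
    by (simp add: locally_exp_concave_on_def)
  have "L_divergence \<alpha> \<phi> \<xi> \<xi>' = log_cost \<alpha> \<xi> (agrad \<xi>') - \<phi> \<xi> - \<psi> (agrad \<xi>')"
    if xi: "\<xi> \<in> \<Omega>" "\<xi>' \<in> \<Omega>" for \<xi> \<xi>'
  proof -
    \<comment> \<open>For distinct points the tangent value lies strictly above the positive number
      \<open>exp (\<alpha> * \<phi> \<xi>)\<close>; for equal points the expression is 1.\<close>
    have "1 + \<alpha> * (grad \<xi>' \<bullet> (\<xi> - \<xi>')) > 0"
    proof (cases "\<xi>' = \<xi>")
      case False
      have "0 < exp (\<alpha> * \<phi> \<xi>)"
        by simp
      also have "\<dots> < exp (\<alpha> * \<phi> \<xi>') * (1 + \<alpha> * (grad \<xi>' \<bullet> (\<xi> - \<xi>')))"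
        using strict_tangent[OF xi(2,1) False] by simp
      finally show ?thesis
        by (simp add: zero_less_mult_iff)
    qed simp
    then show ?thesis
      by (rule self_dual[OF xi(2)])
  qed
  then show "\<forall>\<xi>\<in>\<Omega>. \<forall>\<xi>'\<in>\<Omega>. \<forall>\<eta>'. \<eta>' = agrad \<xi>' \<longrightarrow>
      L_divergence \<alpha> \<phi> \<xi> \<xi>' = log_cost \<alpha> \<xi> \<eta>' - \<phi> \<xi> - \<psi> \<eta>'"
    by blast
next
  fix \<phi> :: "real^'d \<Rightarrow> real"
  assume B: "exp_convex_on \<alpha> \<Omega> \<phi> \<and> conditions_B \<alpha> \<Omega> \<phi>"
  then interpret exp_curved \<alpha> 1 \<Omega> \<phi>
    using exp_curved_B[OF assms] by blast
  show "locally_exp_convex_on \<alpha> (agrad ` \<Omega>) \<psi>"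
    using twice_differentiable_conj definite_conj
    by (simp add: locally_exp_convex_on_def)
  have "L_neg_divergence \<alpha> \<phi> \<xi> \<xi>' = \<phi> \<xi> + \<psi> (agrad \<xi>') - log_cost \<alpha> \<xi> (agrad \<xi>')"
    if xi: "\<xi> \<in> \<Omega>" "\<xi>' \<in> \<Omega>" for \<xi> \<xi>'
  proof -
    have "1 + \<alpha> * (grad \<xi>' \<bullet> (\<xi> - \<xi>')) > 0"
      using B xi unfolding conditions_B_def by blast
    moreover have "L_neg_divergence \<alpha> \<phi> \<xi> \<xi>' = - L_divergence \<alpha> \<phi> \<xi> \<xi>'"
      by (simp add: L_neg_divergence_def L_divergence_def)
    ultimately show ?thesis
      using self_dual[OF xi(2)] by simp
  qed
  then show "\<forall>\<xi>\<in>\<Omega>. \<forall>\<xi>'\<in>\<Omega>. \<forall>\<eta>'. \<eta>' = agrad \<xi>' \<longrightarrow>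
      L_neg_divergence \<alpha> \<phi> \<xi> \<xi>' = \<phi> \<xi> + \<psi> \<eta>' - log_cost \<alpha> \<xi> \<eta>'"
    by blast
qed

end
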